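(* Suppose that a dynamical system $(X,f)$ is totally transitive and uniquely ergodic but not totally uniquely ergodic. Then there exists a prime $p\in\mathbb{N}^+$ such that $Q_{f^p}^e(X)\neq X$.
   Context: A dynamical system $(X,f)$ is a compact metric space $X$ together with a homeomorphism $f:X\to X$. $\mathbb{N}^+$ denotes the positive integers. $(X,f)$ is uniquely ergodic if there is exactly one $f$-invariant Borel probability measure on $X$. It is totally uniquely ergodic if it is uniquely ergodic with unique invariant measure $\mu$ and, for every $n\in\mathbb{N}^+$, $\mu$ is the unique $f^n$-invariant Borel probability measure on $X$. It is topologically transitive if for all non-empty open $U,V\subset X$ there is $k\in\mathbb{N}^+$ with $f^k(U)\cap V\neq\emptyset$; totally transitive if $(X,f^n)$ is topologically transitive for every $n\in\mathbb{N}^+$. For a dynamical system $(X,h)$, $\mathcal{M}_h(X)$ and $\mathcal{M}_h^e(X)$ denote the sets of $h$-invariant, respectively $h$-ergodic, Borel probability measures on $X$. For $x\in X$, $V_h(x)$ denotes the set of weak$^*$ accumulation points of the sequence of empirical measures $\frac1n\sum_{i=0}^{n-1}\delta_{h^i x}$, $n\in\mathbb{N}^+$. For $\mu\in\mathcal{M}_h(X)$ put $G_{h,\mu}=\{x\in X: V_h(x)=\{\mu\}\}$, and put $Q_h^e(X)=\bigcup_{\mu\in\mathcal{M}_h^e(X)}G_{h,\mu}$. *)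

theory Defs
  imports "HOL-Probability.Probability" "HOL-Computational_Algebra.Primes"
begin

(* The phase space X is the universe of a metric type 'a.  Compactness is part of the
   predicate dynamical_system rather than a type class. *)

definition dynamical_system :: "('a::metric_space \<Rightarrow> 'a) \<Rightarrow> bool" where
  "dynamical_system f \<longleftrightarrow> compact (UNIV :: 'a set) \<and> (\<exists>g. homeomorphism UNIV UNIV f g)"

definition borel_probability_measures :: "'a::metric_space measure set" where
  "borel_probability_measures = {M. prob_space M \<and> sets M = sets borel}"

definition invariant_measures :: "('a::metric_space \<Rightarrow> 'a) \<Rightarrow> 'a measure set" where
  "invariant_measures h = {M \<in> borel_probability_measures. distr M M h = M}"

definition ergodic_measures :: "('a::metric_space \<Rightarrow> 'a) \<Rightarrow> 'a measure set" where
  "ergodic_measures h =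
     {M \<in> invariant_measures h.
        \<forall>A\<in>sets M. h -` A = A \<longrightarrow> measure M A = 0 \<or> measure M A = 1}"

definition uniquely_ergodic :: "('a::metric_space \<Rightarrow> 'a) \<Rightarrow> bool" where
  "uniquely_ergodic f \<longleftrightarrow> (\<exists>\<mu>. invariant_measures f = {\<mu>})"

definition totally_uniquely_ergodic :: "('a::metric_space \<Rightarrow> 'a) \<Rightarrow> bool" where
  "totally_uniquely_ergodic f \<longleftrightarrow>
     (\<exists>\<mu>. invariant_measures f = {\<mu>} \<and> (\<forall>n>0. invariant_measures (f ^^ n) = {\<mu>}))"

definition topologically_transitive :: "('a::metric_space \<Rightarrow> 'a) \<Rightarrow> bool" where
  "topologically_transitive f \<longleftrightarrow>
     (\<forall>U V. open U \<and> open V \<and> U \<noteq> {} \<and> V \<noteq> {} \<longrightarrow> (\<exists>k>0. (f ^^ k) ` U \<inter> V \<noteq> {}))"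

definition totally_transitive :: "('a::metric_space \<Rightarrow> 'a) \<Rightarrow> bool" where
  "totally_transitive f \<longleftrightarrow> (\<forall>n>0. topologically_transitive (f ^^ n))"

(* On compact X: the coarsest topology on the Borel probability measures that makes
   the map M \<mapsto> \<integral> \<phi> dM continuous for every continuous real \<phi>. *)
definition weak_star_topology :: "'a::metric_space measure topology" where
  "weak_star_topology = topology_generated_by
     {{M \<in> borel_probability_measures. (\<integral>x. \<phi> x \<partial>M) \<in> U} | (\<phi> :: 'a \<Rightarrow> real) (U :: real set).
        continuous_on UNIV \<phi> \<and> open U}"

lemma topspace_weak_star_topology:
  "topspace weak_star_topology = (borel_probability_measures :: 'a::metric_space measure set)"
proof -
  have "borel_probability_measures \<in>
    {{M \<in> borel_probability_measures. (\<integral>x. \<phi> x \<partial>M) \<in> U} | (\<phi> :: 'a \<Rightarrow> real) (U :: real set).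
        continuous_on UNIV \<phi> \<and> open U}"
    by (intro CollectI exI[of _ "\<lambda>_. 0"] exI[of _ UNIV]) auto
  then show ?thesis
    unfolding weak_star_topology_def topology_generated_by_topspace by blast
qed

definition empirical_measure :: "('a::metric_space \<Rightarrow> 'a) \<Rightarrow> 'a \<Rightarrow> nat \<Rightarrow> 'a measure" where
  "empirical_measure h x n =
     measure_of UNIV (sets borel)
       (\<lambda>A. ennreal (1 / real n) * (\<Sum>i<n. emeasure (return borel ((h ^^ i) x)) A))"

lemma sets_empirical_measure [simp]: "sets (empirical_measure h x n) = sets borel"
  unfolding empirical_measure_def
  using sets.sigma_sets_eq[of borel] by (simp add: sets_measure_of_conv)

lemma space_empirical_measure [simp]: "space (empirical_measure h x n) = UNIV"
  using sets_eq_imp_space_eq[OF sets_empirical_measure[of h x n]] by simp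

lemma emeasure_empirical_measure:
  assumes "A \<in> sets borel"
  shows "emeasure (empirical_measure h x n) A =
    ennreal (1 / real n) * (\<Sum>i<n. emeasure (return borel ((h ^^ i) x)) A)"
proof (rule emeasure_measure_of[OF empirical_measure_def])
  show "countably_additive (sets (empirical_measure h x n))
     (\<lambda>A. ennreal (1 / real n) * (\<Sum>i<n. emeasure (return borel ((h ^^ i) x)) A))"
    unfolding countably_additive_def
  proof (intro allI impI)
    fix F :: "nat \<Rightarrow> 'a set"
    assume F: "range F \<subseteq> sets (empirical_measure h x n)" "disjoint_family F"
    have "(\<Sum>k. \<Sum>i<n. emeasure (return borel ((h ^^ i) x)) (F k)) =
        (\<Sum>i<n. \<Sum>k. emeasure (return borel ((h ^^ i) x)) (F k))"
      by (rule suminf_sum) simp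
    also have "\<dots> = (\<Sum>i<n. emeasure (return borel ((h ^^ i) x)) (\<Union>k. F k))"
      using F by (intro sum.cong refl suminf_emeasure) auto
    finally show "(\<Sum>k. ennreal (1 / real n) *
          (\<Sum>i<n. emeasure (return borel ((h ^^ i) x)) (F k))) =
        ennreal (1 / real n) * (\<Sum>i<n. emeasure (return borel ((h ^^ i) x)) (\<Union>k. F k))"
      by simp
  qed
qed (use assms in \<open>auto simp: positive_def\<close>)

lemma empirical_measure_in_borel_probability_measures:
  assumes "n > 0"
  shows "empirical_measure h x n \<in> borel_probability_measures"
proof -
  have "emeasure (empirical_measure h x n) UNIV = ennreal (1 / real n) * ennreal (real n)"
    by (simp add: emeasure_empirical_measure ennreal_of_nat_eq_real_of_nat)
  also have "\<dots> = 1"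
    using assms by (simp add: ennreal_mult[symmetric])
  finally show ?thesis
    by (auto simp: borel_probability_measures_def intro!: prob_spaceI)
qed

(* Accumulation points of the sequence, not of its range: every neighbourhood contains
   infinitely many terms, counted by index. *)
definition accumulation_points :: "'b topology \<Rightarrow> (nat \<Rightarrow> 'b) \<Rightarrow> 'b set" where
  "accumulation_points T s =
     {l \<in> topspace T. \<forall>U. openin T U \<and> l \<in> U \<longrightarrow> (\<exists>\<^sub>F n in sequentially. s n \<in> U)}"

(* The term with index 0 is the null measure; it does not affect accumulation points. *)
definition V_set :: "('a::metric_space \<Rightarrow> 'a) \<Rightarrow> 'a \<Rightarrow> 'a measure set" where
  "V_set h x = accumulation_points weak_star_topology (empirical_measure h x)"

definition G_set :: "('a::metric_space \<Rightarrow> 'a) \<Rightarrow> 'a measure \<Rightarrow> 'a set" where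
  "G_set h \<mu> = {x. V_set h x = {\<mu>}}"

definition Q_e :: "('a::metric_space \<Rightarrow> 'a) \<Rightarrow> 'a set" where
  "Q_e h = (\<Union>\<mu>\<in>ergodic_measures h. G_set h \<mu>)"

end

theory Submission
  imports Defs
begin

text \<open>Suppose every point is generic for an ergodic measure of \<open>T = f^p\<close>. Choose \<open>x\<close> with dense \<open>T\<close>-orbit and let
  \<open>\<nu>\<close> be its measure. The points whose empirical measures accumulate at \<open>\<nu>\<close> form a \<open>G\<^sub>\<delta>\<close> set
  containing the orbit of \<open>x\<close>, hence a residual set; likewise for the image of \<open>\<nu>\<close> under \<open>f\<close> and the point
  \<open>f x\<close>. By Baire some point accumulates at both measures, so they coincide, \<open>\<nu>\<close> is \<open>f\<close>-invariant and equals
  the unique invariant measure \<open>\<mu>\<close>. If this happens for every prime \<open>p\<close>, then \<open>\<mu>\<close> is \<open>f^p\<close>-ergodic for every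
  prime \<open>p\<close>, hence \<open>f^n\<close>-ergodic for every \<open>n > 0\<close>. An \<open>f^n\<close>-invariant measure averages along \<open>f\<close> to \<open>\<mu>\<close>,
  so it is absolutely continuous with respect to \<open>\<mu>\<close> and by ergodicity equal to it: \<open>f\<close> is totally uniquely
  ergodic.\<close>

section \<open>Ergodic measures of iterates\<close>

lemma borel_measurable_funpow:
  fixes f :: "'a::topological_space \<Rightarrow> 'a"
  assumes "f \<in> borel_measurable borel"
  shows "(f ^^ k) \<in> borel_measurable borel"
  by (induction k) (use assms in \<open>auto simp: id_def\<close>)

lemma invariant_measuresD:
  assumes "M \<in> invariant_measures h"
  shows "prob_space M" "sets M = sets borel" "space M = UNIV" "distr M M h = M"
proof -
  show s: "sets M = sets borel" and "prob_space M" "distr M M h = M"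
    using assms by (auto simp: invariant_measures_def borel_probability_measures_def)
  show "space M = UNIV"
    using sets_eq_imp_space_eq[OF s] by simp
qed

lemma emeasure_vimage_invariant:
  assumes "M \<in> invariant_measures h" and h: "h \<in> borel_measurable borel" and "A \<in> sets borel"
  shows "emeasure M (h -` A) = emeasure M A"
proof -
  note M = invariant_measuresD[OF assms(1)]
  have "h \<in> measurable M M"
    using h by (simp add: measurable_cong_sets[OF M(2) M(2)])
  then have "emeasure (distr M M h) A = emeasure M (h -` A \<inter> space M)"
    by (rule emeasure_distr) (simp add: M assms)
  then show ?thesis by (simp add: M)
qed

text \<open>Both total masses are 1, so the inequality for the complement of a set is the reverse
  inequality for the set.\<close>

lemma prob_measure_eqI_le:
  assumes "prob_space M" "prob_space N" "sets M = sets N"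
    and le: "\<And>A. A \<in> sets M \<Longrightarrow> emeasure M A \<le> emeasure N A"
  shows "M = N"
proof (rule measure_eqI[OF assms(3)])
  interpret M: prob_space M by fact
  interpret N: prob_space N by fact
  fix A assume A: "A \<in> sets M"
  have sp: "space M = space N" by (rule sets_eq_imp_space_eq[OF assms(3)])
  have "measure M (space M - A) \<le> measure N (space N - A)"
    using le[OF sets.compl_sets[OF A]] unfolding sp by (simp add: M.emeasure_eq_measure N.emeasure_eq_measure)
  then have "measure N A \<le> measure M A"
    using A assms(3) by (simp add: M.prob_compl N.prob_compl)
  then show "emeasure M A = emeasure N A"
    using le[OF A] by (simp add: M.emeasure_eq_measure N.emeasure_eq_measure)
qed

text \<open>Uniqueness of the Radon--Nikodym density \<open>h\<close> makes it \<open>T\<close>-invariant almost everywhere, so \<open>{h \<le> 1}\<close>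
  agrees almost everywhere with the strictly invariant set \<open>B\<close> below. Either value of \<open>\<kappa> B\<close> makes one
  of the two probability measures dominate the other, which forces equality.\<close>
lemma ergodic_absolutely_continuous_unique:
  assumes \<kappa>: "\<kappa> \<in> ergodic_measures T" and \<nu>: "\<nu> \<in> invariant_measures T"
    and ac: "absolutely_continuous \<kappa> \<nu>"
    and T: "T \<in> borel_measurable borel" and g: "g \<in> borel_measurable borel"
    and gT: "\<And>x. g (T x) = x"
  shows "\<nu> = \<kappa>"
proof -
  have \<kappa>i: "\<kappa> \<in> invariant_measures T"
    using \<kappa> by (simp add: ergodic_measures_def)
  note K = invariant_measuresD[OF \<kappa>i] and N = invariant_measuresD[OF \<nu>]
  interpret K: prob_space \<kappa> by fact
  interpret N: prob_space \<nu> by fact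
  have [measurable]: "T \<in> measurable \<kappa> \<kappa>" "g \<in> measurable \<kappa> \<kappa>"
    using T g by (simp_all add: measurable_cong_sets[OF K(2) K(2)])
  have [measurable_cong]: "sets \<kappa> = sets borel" by (rule K)
  define h where "h = RN_deriv \<kappa> \<nu>"
  have h[measurable]: "h \<in> borel_measurable \<kappa>" by (simp add: h_def)
  have dens: "density \<kappa> h = \<nu>"
    unfolding h_def by (rule K.density_RN_deriv[OF ac]) (simp add: K N)
  have dN: "distr \<nu> \<kappa> T = \<nu>"
    using N(4) distr_cong[of \<nu> \<nu> \<kappa> \<nu> T T] by (simp add: K N)
  \<comment> \<open>The inverse \<open>g\<close> allows densities to be transported along
    \<open>T\<close>. As \<open>T\<close> preserves both measures, the transported density is the
    original one.\<close>
  have "AE x in \<kappa>. RN_deriv (distr \<kappa> \<kappa> T) (distr \<nu> \<kappa> T) (T x) = RN_deriv \<kappa> \<nu> x"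
    by (rule K.RN_deriv_distr[of T \<kappa> g]) (use gT ac in \<open>auto simp: K N dN\<close>)
  then have hT: "AE x in \<kappa>. h (T x) = h x"
    by (simp add: dN K(4) h_def)
  have hTn: "AE x in \<kappa>. h ((T ^^ n) x) = h x" for n
  proof (induction n)
    case (Suc n)
    have "AE x in distr \<kappa> \<kappa> T. h ((T ^^ n) x) = h x"
      using Suc by (subst K(4))
    then have "AE x in \<kappa>. h ((T ^^ n) (T x)) = h (T x)"
      by (rule AE_distrD[rotated]) simp
    with hT show ?case
      by eventually_elim (simp add: funpow_Suc_right del: funpow.simps)
  qed simp
  \<comment> \<open>Asking for infinitely many times along the orbit makes the condition insensitive
    to the first term, so \<open>B\<close> equals its preimage under \<open>T\<close> exactly.
    \<open>ergodic_measures\<close> speaks of exactly invariant sets only, which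
    \<open>{x. h x \<le> 1}\<close> need not be.\<close>
  define B where "B = {x. \<exists>\<^sub>F n in sequentially. h ((T ^^ n) x) \<le> 1}"
  have Bm: "B \<in> sets \<kappa>"
  proof -
    have [measurable]: "(T ^^ n) \<in> measurable \<kappa> \<kappa>" for n
      by (induction n) (auto simp: id_def)
    have "{x \<in> space \<kappa>. \<forall>m. \<exists>n. m \<le> n \<and> h ((T ^^ n) x) \<le> 1} \<in> sets \<kappa>"
      by measurable
    then show ?thesis by (simp add: B_def frequently_sequentially K)
  qed
  have "T -` B = B"
  proof -
    have "(\<exists>\<^sub>F n in sequentially. h ((T ^^ n) (T x)) \<le> 1) \<longleftrightarrow> (\<exists>\<^sub>F n in sequentially. h ((T ^^ n) x) \<le> 1)" for x
      using eventually_sequentially_Suc[of "\<lambda>n. \<not> h ((T ^^ n) x) \<le> 1"]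
      by (simp add: frequently_def funpow_Suc_right del: funpow.simps)
    then show ?thesis by (auto simp: B_def)
  qed
  with \<kappa> Bm have B01: "measure \<kappa> B = 0 \<or> measure \<kappa> B = 1"
    by (auto simp: ergodic_measures_def)
  have "AE x in \<kappa>. \<forall>n. h ((T ^^ n) x) = h x"
    using hTn by (simp add: AE_all_countable)
  then have B_iff: "AE x in \<kappa>. x \<in> B \<longleftrightarrow> h x \<le> 1"
    by eventually_elim (simp add: B_def)
  from B01 show ?thesis
  proof
    assume "measure \<kappa> B = 1"
    then have "AE x in \<kappa>. x \<in> B" using K.prob_eq_1[OF Bm] by simp
    with B_iff have h1: "AE x in \<kappa>. h x \<le> 1" by eventually_elim simp
    show ?thesis
    proof (rule prob_measure_eqI_le)
      fix A assume A: "A \<in> sets \<nu>"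
      then have A': "A \<in> sets \<kappa>" by (simp add: K N)
      have "emeasure \<nu> A = (\<integral>\<^sup>+x. h x * indicator A x \<partial>\<kappa>)"
        using emeasure_density[OF h A'] by (simp add: dens)
      also have "\<dots> \<le> (\<integral>\<^sup>+x. indicator A x \<partial>\<kappa>)"
        by (rule nn_integral_mono_AE) (use h1 in eventually_elim, auto split: split_indicator)
      finally show "emeasure \<nu> A \<le> emeasure \<kappa> A" using A' by simp
    qed (simp_all add: K N)
  next
    assume "measure \<kappa> B = 0"
    then have "AE x in \<kappa>. x \<notin> B"
      using Bm by (intro AE_not_in) (simp add: K.emeasure_eq_measure null_setsI)
    with B_iff have h1: "AE x in \<kappa>. 1 \<le> h x" by eventually_elim auto
    show ?thesis
    proof (rule prob_measure_eqI_le[symmetric])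
      fix A assume A': "A \<in> sets \<kappa>"
      have "(\<integral>\<^sup>+x. indicator A x \<partial>\<kappa>) \<le> (\<integral>\<^sup>+x. h x * indicator A x \<partial>\<kappa>)"
        by (rule nn_integral_mono_AE) (use h1 in eventually_elim, auto split: split_indicator)
      also have "\<dots> = emeasure \<nu> A"
        using emeasure_density[OF h A'] by (simp add: dens)
      finally show "emeasure \<kappa> A \<le> emeasure \<nu> A" using A' by simp
    qed (simp_all add: K N)
  qed
qed

section \<open>Passing between a map and its iterates\<close>

lemma invariant_measures_funpow:
  assumes h: "h \<in> borel_measurable borel" and M: "M \<in> invariant_measures h"
  shows "M \<in> invariant_measures (h ^^ n)"
proof -
  note K = invariant_measuresD[OF M]
  have hm: "h \<in> measurable M M"
    using h by (simp add: measurable_cong_sets[OF K(2) K(2)])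
  have "distr M M (h ^^ n) = M \<and> h ^^ n \<in> measurable M M"
  proof (induction n)
    case (Suc n)
    have "distr M M (h \<circ> h ^^ n) = distr (distr M M (h ^^ n)) M h"
      using hm Suc by (intro distr_distr[symmetric]) auto
    then show ?case using Suc hm K(4) measurable_comp[of "h ^^ n" M M h M] by (simp add: comp_def)
  qed (simp add: id_def distr_id2)
  then show ?thesis using M by (simp add: invariant_measures_def)
qed

text \<open>A set invariant under \<open>h\<close> is invariant under \<open>h ^^ n\<close> too, so
  ergodicity of the iterate tests more sets.\<close>

lemma ergodic_measures_of_funpow:
  assumes "M \<in> invariant_measures h" "M \<in> ergodic_measures (h ^^ n)"
  shows "M \<in> ergodic_measures h"
  unfolding ergodic_measures_def
proof (intro CollectI conjI ballI impI)
  fix A assume A: "A \<in> sets M" "h -` A = A"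
  have "(h ^^ n) -` A = A"
  proof (induction n)
    case (Suc n)
    then show ?case using A(2) by (simp only: funpow.simps vimage_comp[symmetric])
  qed simp
  with A assms show "measure M A = 0 \<or> measure M A = 1"
    by (auto simp: ergodic_measures_def)
qed fact

text \<open>The fibres of \<open>g\<close> are finitely many invariant sets that partition the
  space. Some fibre has nonzero measure, and ergodicity makes it full.\<close>

lemma ergodic_finite_range_const:
  fixes g :: "'a::metric_space \<Rightarrow> 'b"
  assumes M: "M \<in> ergodic_measures h" and fin: "finite (range g)"
    and meas: "\<And>v. g -` {v} \<in> sets borel" and inv: "\<And>x. g (h x) = g x"
  obtains v where "measure M (g -` {v}) = 1"
proof -
  have Mi: "M \<in> invariant_measures h" using M by (simp add: ergodic_measures_def)
  note K = invariant_measuresD[OF Mi]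
  interpret prob_space M by fact
  have UN: "(\<Union>v\<in>range g. g -` {v}) = UNIV" by auto
  have prob_space_UNIV: "measure M UNIV = 1" using prob_space by (simp add: K)
  have "1 = measure M (\<Union>v\<in>range g. g -` {v})"
    by (simp only: UN prob_space_UNIV)
  also have "\<dots> = (\<Sum>v\<in>range g. measure M (g -` {v}))"
    by (rule finite_measure_finite_Union[OF fin]) (auto simp: disjoint_family_on_def K meas)
  finally have "(\<Sum>v\<in>range g. measure M (g -` {v})) \<noteq> 0" by simp
  then obtain v where "measure M (g -` {v}) \<noteq> 0"
    by (rule sum.not_neutral_contains_not_neutral)
  moreover have "h -` g -` {v} = g -` {v}" using inv by auto
  moreover have "g -` {v} \<in> sets M" using meas[of v] by (simp add: K)
  ultimately have "measure M (g -` {v}) = 1"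
    using M unfolding ergodic_measures_def by blast
  then show ?thesis by (rule that)
qed

text \<open>Code \<open>x\<close> by its itinerary \<open>P x\<close> through an \<open>f^n\<close>-invariant set \<open>A\<close>. Itineraries are \<open>n\<close>-periodic, and by
  ergodicity of \<open>f\<close> almost all of them are shifts of a single one, \<open>q\<close>, of least period \<open>d\<close>. If \<open>d = 1\<close> then
  \<open>A\<close> is trivial; otherwise, for a prime \<open>p\<close> dividing \<open>d\<close>, the sets \<open>B j\<close> of points whose shift is \<open>j\<close> modulo
  \<open>p\<close> are \<open>p\<close> disjoint \<open>f^p\<close>-invariant sets of equal measure.\<close>
lemma ergodic_funpow_of_primes:
  fixes f :: "'a::metric_space \<Rightarrow> 'a"
  assumes f: "f \<in> borel_measurable borel" and \<mu>: "\<mu> \<in> ergodic_measures f"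
    and primes: "\<And>p. prime p \<Longrightarrow> \<mu> \<in> ergodic_measures (f ^^ p)" and n: "n > 0"
  shows "\<mu> \<in> ergodic_measures (f ^^ n)"
proof -
  have \<mu>i: "\<mu> \<in> invariant_measures f" using \<mu> by (simp add: ergodic_measures_def)
  note K = invariant_measuresD[OF \<mu>i]
  interpret prob_space \<mu> by fact
  note fn = borel_measurable_funpow[OF f]
  have "measure \<mu> A = 0 \<or> measure \<mu> A = 1" if A: "A \<in> sets \<mu>" "(f ^^ n) -` A = A" for A
  proof -
    define P where "P x = (\<lambda>i. (f ^^ i) x \<in> A)" for x
    define s where "s k q = (\<lambda>i. q (i + k))" for k :: nat and q :: "nat \<Rightarrow> bool"
    have s_add: "s j (s k q) = s (j + k) q" for j k q
      by (simp add: s_def ac_simps)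
    have s0: "s 0 q = q" for q by (simp add: s_def)
    have Ps: "P ((f ^^ k) x) = s k (P x)" for k x
      by (simp add: P_def s_def funpow_add)
    have Ps1: "P (f x) = s 1 (P x)" for x
      using Ps[of 1] by simp
    have per: "s n (P x) = P x" for x
    proof -
      have "P x (i + n) = P x i" for i
        using A(2) by (subst add.commute) (auto simp: P_def funpow_add)
      then show ?thesis by (simp add: s_def)
    qed
    have perm: "s (m * n) (P x) = P x" for m x
      by (induction m) (simp_all add: s0 per flip: s_add)
    have fin: "finite (range P)"
    proof (rule finite_subset)
      \<comment> \<open>An itinerary of period \<open>n\<close> is determined by the set of times
        below \<open>n\<close> spent in \<open>A\<close>.\<close>
      show "range P \<subseteq> (\<lambda>S i. i mod n \<in> S) ` Pow {..<n}"
      proof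
        fix q assume "q \<in> range P"
        then obtain x where q: "q = P x" by auto
        have "P x i = P x (i mod n)" for i
          using fun_cong[OF perm[of "i div n" x], of "i mod n"]
          by (simp add: s_def mod_mult_div_eq mult.commute)
        then have "q = (\<lambda>i. i mod n \<in> {i. i < n \<and> P x i})"
          using n by (auto simp: q fun_eq_iff)
        then show "q \<in> (\<lambda>S i. i mod n \<in> S) ` Pow {..<n}" by blast
      qed
    qed simp
    have P_meas: "P -` Z \<in> sets borel" for Z
    proof -
      have 1: "P -` {q} \<in> sets borel" for q
      proof -
        have "{x. (f ^^ i) x \<in> A \<longleftrightarrow> q i} \<in> sets borel" for i
        proof -
          have "(f ^^ i) -` A \<in> sets borel"
            using measurable_sets[OF fn[of i], of A] A by (simp add: K)
          moreover have "{x. (f ^^ i) x \<in> A \<longleftrightarrow> q i} = (if q i then (f ^^ i) -` A else - ((f ^^ i) -` A))"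
            by auto
          ultimately show ?thesis by auto
        qed
        then have "(\<Inter>i. {x. (f ^^ i) x \<in> A \<longleftrightarrow> q i}) \<in> sets borel"
          by (intro sets.countable_INT) auto
        moreover have "P -` {q} = (\<Inter>i. {x. (f ^^ i) x \<in> A \<longleftrightarrow> q i})"
          by (auto simp: P_def fun_eq_iff)
        ultimately show ?thesis by simp
      qed
      have "P -` Z = (\<Union>q\<in>Z \<inter> range P. P -` {q})" by auto
      moreover have "(\<Union>q\<in>Z \<inter> range P. P -` {q}) \<in> sets borel"
        by (intro sets.finite_UN) (use fin 1 in auto)
      ultimately show ?thesis by simp
    qed
    \<comment> \<open>\<open>g x\<close> is the shift orbit of the itinerary. Applying
      \<open>f\<close> shifts the itinerary by one, and \<open>n - 1\<close> further shifts return
      to the start, so the orbit is unchanged.\<close>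
    define g where "g x = range (\<lambda>k. s k (P x))" for x
    obtain v where v: "measure \<mu> (g -` {v}) = 1"
    proof (rule ergodic_finite_range_const[OF \<mu>, of g])
      have "range g = (\<lambda>q. range (\<lambda>k. s k q)) ` range P"
        by (auto simp: g_def)
      then show "finite (range g)" using fin by simp
      have "g -` {v} = P -` {q. range (\<lambda>k. s k q) = v}" for v
        by (auto simp: g_def)
      then show "g -` {v} \<in> sets borel" for v by (simp only: P_meas)
      show "g (f x) = g x" for x
      proof -
        have "s k (P x) = s ((k + n - 1) + 1) (P x)" for k
          using n per[of x] by (simp flip: s_add)
        then have "s k (P x) \<in> range (\<lambda>k. s (k + 1) (P x))" for k by blast
        then show ?thesis by (auto simp: g_def Ps1 s_add)
      qed
    qed
    then obtain x0 where x0: "g x0 = v"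
      by (metis measure_empty vimage_singleton_eq equals0I zero_neq_one)
    define q where "q = P x0"
    have qn: "s (m * n) q = q" for m by (simp add: q_def perm)
    \<comment> \<open>Fixing a representative \<open>q\<close> of the almost sure shift orbit,
      almost every itinerary is a shift of \<open>q\<close>.\<close>
    define F where "F = {x. \<exists>k. P x = s k q}"
    have Fm: "F \<in> sets \<mu>"
      using P_meas[of "{r. \<exists>k. r = s k q}"] by (simp add: K F_def vimage_def)
    have "g -` {v} \<subseteq> F"
      using x0 s0 by (auto simp: g_def F_def q_def) (metis rangeI rangeE)
    then have F1: "measure \<mu> F = 1"
      using v finite_measure_mono[of "g -` {v}" F] Fm prob_le_1[of F] by simp
    \<comment> \<open>\<open>n\<close> is a candidate, so the minimum exists. Division with
      remainder then shows that it divides every shift fixing \<open>q\<close>.\<close>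
    define d where "d = (LEAST d. d > 0 \<and> s d q = q)"
    have d: "d > 0" "s d q = q"
      using LeastI[of "\<lambda>d. d > 0 \<and> s d q = q" n] n qn[of 1] by (auto simp: d_def)
    have d_dvd: "d dvd a" if "s a q = q" for a
    proof -
      have "s (d * m) q = q" for m
        by (induction m) (simp_all add: s0 d flip: s_add)
      then have "s (a mod d) q = s (a mod d + d * (a div d)) q"
        by (simp only: s_add[symmetric])
      then have "s (a mod d) q = q" using that by simp
      moreover have "a mod d < d" using d by simp
      ultimately have "\<not> a mod d > 0"
        using not_less_Least[of "a mod d" "\<lambda>d. d > 0 \<and> s d q = q"] by (auto simp: d_def)
      then show ?thesis by (simp add: mod_eq_0_iff_dvd)
    qed
    have d_dvd2: "int d dvd int j - int k" if "s j q = s k q" for j k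
    proof -
      \<comment> \<open>Shifting both sides by \<open>(n - 1) * k\<close> turns the right one into a
        shift by \<open>k * n\<close>, which fixes \<open>q\<close>. So \<open>d\<close> divides
        \<open>(n - 1) * k + j\<close>; since \<open>d\<close> also divides \<open>n\<close>, this
        is congruent to \<open>j - k\<close>. Integers avoid truncated subtraction.\<close>
      have "s ((n - 1) * k) (s j q) = s ((n - 1) * k) (s k q)"
        using that by simp
      then have "s ((n - 1) * k + j) q = s ((n - 1) * k + k) q"
        by (simp add: s_add)
      also have "(n - 1) * k + k = k * n" using n by (cases n) auto
      finally have "d dvd (n - 1) * k + j" using d_dvd qn by simp
      moreover have "d dvd n" using d_dvd qn[of 1] by simp
      ultimately have "int d dvd int ((n - 1) * k + j) - int k * int n"
        by (intro dvd_diff dvd_mult) (simp_all only: int_dvd_int_iff)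
      moreover have "int ((n - 1) * k + j) - int k * int n = int j - int k"
        using n by (cases n) (simp_all add: algebra_simps)
      ultimately show ?thesis by (simp only:)
    qed
    show ?thesis
    proof (cases "d = 1")
      case True
      have sq: "s k q = q" for k
      proof (induction k)
        case (Suc k)
        have "s (Suc k) q = s k (s d q)" using True by (simp add: s_add)
        then show ?case by (simp only: d(2) Suc.IH)
      qed (rule s0)
      have FA: "x \<in> A \<longleftrightarrow> q 0" if "x \<in> F" for x
      proof -
        have "P x = q" using that sq by (auto simp: F_def)
        then have "P x 0 = q 0" by simp
        then show ?thesis by (simp add: P_def)
      qed
      show ?thesis
      proof (cases "q 0")
        case True
        then have "F \<subseteq> A" using FA by auto
        then show ?thesis
          using F1 finite_measure_mono[of F A] A prob_le_1[of A] by simp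
      next
        case False
        then have "A \<subseteq> space \<mu> - F" using FA by (auto simp: K)
        then have "measure \<mu> A \<le> 0"
          using finite_measure_mono[of A "space \<mu> - F"] Fm F1 prob_compl[OF Fm] by simp
        then show ?thesis by (simp add: measure_le_0_iff)
      qed
    next
      case False
      then obtain p where p: "prime p" "p dvd d" by (metis prime_factor_nat)
      \<comment> \<open>By \<open>d_dvd2\<close> the shift of an itinerary relative to
        \<open>q\<close> is determined modulo \<open>d\<close>, hence modulo its divisor
        \<open>p\<close>. The sets \<open>B j\<close> sort the points of \<open>F\<close> by this
        residue.\<close>
      define B where "B j = {x. \<exists>i. P x = s (p * i + j) q}" for j
      have Bm: "B j \<in> sets \<mu>" for j
        using P_meas[of "{r. \<exists>i. r = s (p * i + j) q}"] by (simp add: K B_def vimage_def)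
      have fB: "f -` B (Suc j) = B j" for j
      proof (intro set_eqI iffI)
        fix x assume "x \<in> B j"
        then obtain i where "P x = s (p * i + j) q" by (auto simp: B_def)
        then have "P (f x) = s (p * i + Suc j) q" by (simp add: Ps1 s_add)
        then show "x \<in> f -` B (Suc j)" by (auto simp: B_def)
      next
        fix x assume "x \<in> f -` B (Suc j)"
        then obtain i where i: "s 1 (P x) = s (p * i + Suc j) q" by (auto simp: B_def Ps1)
        \<comment> \<open>The shift by one is undone by \<open>n - 1\<close> more; together they are
          a full period, absorbed by \<open>qn\<close>.\<close>
        have "P x = s (n - 1) (s 1 (P x))" using n per[of x] by (simp add: s_add)
        also have "\<dots> = s (p * i + j) (s (1 * n) q)"
          unfolding i using n by (cases n) (simp_all add: s_add ac_simps)
        finally have "P x = s (p * i + j) q" by (simp only: qn)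
        then show "x \<in> B j" by (auto simp: B_def)
      qed
      \<comment> \<open>Preimages under \<open>f\<close> step down through the sets
        \<open>B j\<close>, so invariance of the measure equates their masses.\<close>
      have B_eq: "measure \<mu> (B j) = measure \<mu> (B 0)" for j
      proof (induction j)
        case (Suc j)
        then show ?case
          using emeasure_vimage_invariant[OF \<mu>i f, of "B (Suc j)"] Bm[of "Suc j"]
          by (simp add: fB K measure_def)
      qed simp
      have "(f ^^ p) -` B 0 = B 0"
      proof (intro set_eqI iffI)
        fix x assume "x \<in> B 0"
        then obtain i where "P x = s (p * i) q" by (auto simp: B_def)
        then have "P ((f ^^ p) x) = s (p * Suc i + 0) q" by (simp add: Ps s_add)
        then show "x \<in> (f ^^ p) -` B 0" unfolding B_def by blast
      next
        fix x assume "x \<in> (f ^^ p) -` B 0"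
        then obtain i where i: "s p (P x) = s (p * i) q" by (auto simp: B_def Ps)
        have "P x = s (p * n) (P x)" by (simp add: perm)
        also have "p * n = p * (n - 1) + p" using n by (cases n) auto
        also have "s \<dots> (P x) = s (p * (n - 1)) (s p (P x))" by (simp add: s_add)
        also have "\<dots> = s (p * (n - 1 + i) + 0) q" unfolding i by (simp add: s_add algebra_simps)
        finally show "x \<in> B 0" unfolding B_def by blast
      qed
      then have "measure \<mu> (B 0) = 0 \<or> measure \<mu> (B 0) = 1"
        using primes[OF p(1)] Bm[of 0] by (auto simp: ergodic_measures_def)
      moreover have "measure \<mu> (B 0) \<noteq> 0"
      proof
        assume 0: "measure \<mu> (B 0) = 0"
        have "F \<subseteq> (\<Union>j<p. B j)"
        proof
          fix x assume "x \<in> F"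
          then obtain k where "P x = s k q" by (auto simp: F_def)
          then have "P x = s (p * (k div p) + k mod p) q" by simp
          moreover have "k mod p < p" using p by (simp add: prime_gt_0_nat)
          ultimately show "x \<in> (\<Union>j<p. B j)" unfolding B_def by blast
        qed
        then have "measure \<mu> F \<le> measure \<mu> (\<Union>j<p. B j)"
          by (rule finite_measure_mono) (use Bm in auto)
        also have "\<dots> \<le> (\<Sum>j<p. measure \<mu> (B j))"
          by (rule finite_measure_subadditive_finite) (use Bm in auto)
        also have "\<dots> = 0" using B_eq 0 by simp
        finally show False using F1 by simp
      qed
      moreover have "measure \<mu> (B 0) \<noteq> 1"
      proof
        assume 1: "measure \<mu> (B 0) = 1"
        \<comment> \<open>A common point would have a shift congruent to both 0 and 1 modulo
          \<open>p\<close>, so \<open>p\<close> would divide 1. Two disjoint sets of measure 1 then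
          exceed the total mass.\<close>
        have "B 0 \<inter> B 1 = {}"
        proof (rule ccontr)
          assume "B 0 \<inter> B 1 \<noteq> {}"
          then obtain x i i' where "P x = s (p * i + 0) q" "P x = s (p * i' + 1) q"
            unfolding B_def by blast
          then have "s (p * i) q = s (p * i' + 1) q" by simp
          from d_dvd2[OF this] have "int d dvd int p * (int i - int i') - 1"
            by (simp add: algebra_simps)
          moreover have "int p dvd int d" using p by simp
          ultimately have "int p dvd int p * (int i - int i') - 1" by (rule dvd_trans[rotated])
          then have "int p dvd int p * (int i - int i') - (int p * (int i - int i') - 1)"
            by (rule dvd_diff[OF dvd_triv_left])
          then have "int p dvd int 1" by (simp only: diff_diff_eq2 add_diff_cancel_left' of_nat_1)
          then show False using p(1) by (simp only: int_dvd_int_iff not_prime_unit)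
        qed
        then have "measure \<mu> (B 0 \<union> B 1) = 2"
          using finite_measure_Union[of "B 0" "B 1"] Bm 1 B_eq[of 1] by simp
        then show False using prob_le_1[of "B 0 \<union> B 1"] by simp
      qed
      ultimately show ?thesis by blast
    qed
  qed
  then show ?thesis
    using invariant_measures_funpow[OF f \<mu>i, of n] by (auto simp: ergodic_measures_def)
qed

text \<open>\<open>M\<close> is the mean of the images of \<nu> under the first \<open>n\<close>
  powers of \<open>f\<close>. Taking preimages under \<open>f\<close> moves each summand to the
  next, and invariance under \<open>f ^^ n\<close> identifies the new last one with the old first
  one.\<close>

lemma average_invariant_measure:
  fixes f :: "'a::metric_space \<Rightarrow> 'a"
  assumes f: "f \<in> borel_measurable borel" and \<nu>: "\<nu> \<in> invariant_measures (f ^^ n)" and n: "n > 0"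
  obtains M where "M \<in> invariant_measures f"
    "\<And>A. A \<in> sets borel \<Longrightarrow>
       emeasure M A = ennreal (1 / real n) * (\<Sum>j<n. emeasure \<nu> ((f ^^ j) -` A))"
proof -
  note N = invariant_measuresD[OF \<nu>]
  note fn = borel_measurable_funpow[OF f]
  have fA: "(f ^^ i) -` A \<in> sets \<nu>" if "A \<in> sets borel" for A i
    using measurable_sets[OF fn[of i] that] by (simp add: N)
  define a where "a = (\<lambda>A. ennreal (1 / real n) * (\<Sum>j<n. emeasure \<nu> ((f ^^ j) -` A)))"
  define M where "M = measure_of UNIV (sets borel) a"
  have sM: "sets M = sets borel"
    unfolding M_def using sets.sigma_sets_eq[of borel] by (simp add: sets_measure_of_conv)
  have spM: "space M = UNIV" using sets_eq_imp_space_eq[OF sM] by simp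
  have eM: "emeasure M A = a A" if "A \<in> sets borel" for A
  proof (rule emeasure_measure_of[OF M_def])
    show "countably_additive (sets M) a"
      unfolding countably_additive_def
    proof (intro allI impI)
      fix F :: "nat \<Rightarrow> 'a set"
      assume F: "range F \<subseteq> sets M" "disjoint_family F"
      have "(\<Sum>k. \<Sum>j<n. emeasure \<nu> ((f ^^ j) -` F k)) =
          (\<Sum>j<n. \<Sum>k. emeasure \<nu> ((f ^^ j) -` F k))"
        by (rule suminf_sum) simp
      also have "\<dots> = (\<Sum>j<n. emeasure \<nu> ((f ^^ j) -` (\<Union>k. F k)))"
      proof (intro sum.cong refl)
        fix j
        have "disjoint_family (\<lambda>k. (f ^^ j) -` F k)"
          using F(2) by (auto simp: disjoint_family_on_def)
        then have "(\<Sum>k. emeasure \<nu> ((f ^^ j) -` F k)) = emeasure \<nu> (\<Union>k. (f ^^ j) -` F k)"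
          using F(1) fA by (intro suminf_emeasure) (auto simp: sM)
        then show "(\<Sum>k. emeasure \<nu> ((f ^^ j) -` F k)) = emeasure \<nu> ((f ^^ j) -` (\<Union>k. F k))"
          by (simp add: vimage_UN)
      qed
      finally show "(\<Sum>k. a (F k)) = a (\<Union>k. F k)"
        by (simp add: a_def)
    qed
  qed (use that in \<open>auto simp: positive_def a_def sM\<close>)
  have "emeasure M (space M) = ennreal (1 / real n) * ennreal (real n)"
    using prob_space.emeasure_space_1[OF N(1)]
    by (simp add: eM spM a_def N ennreal_of_nat_eq_real_of_nat)
  also have "\<dots> = 1"
    using n by (simp add: ennreal_mult[symmetric])
  finally have "prob_space M" by (rule prob_spaceI)
  moreover have "distr M M f = M"
  proof (rule measure_eqI)
    fix A assume "A \<in> sets (distr M M f)"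
    then have A: "A \<in> sets borel" by (simp add: sM)
    have fM: "f \<in> measurable M M" using f by (simp add: measurable_cong_sets[OF sM sM])
    have fA': "f -` A \<in> sets borel" using fA[OF A, of 1] by (simp add: N)
    define b where "b j = emeasure \<nu> ((f ^^ j) -` A)" for j
    have "b n = b 0"
      using emeasure_vimage_invariant[OF \<nu> fn A] by (simp add: b_def)
    moreover have "b 0 + (\<Sum>j<n. b (Suc j)) = (\<Sum>j<n. b j) + b n"
      by (metis sum.lessThan_Suc sum.lessThan_Suc_shift)
    \<comment> \<open>Finiteness is what permits cancelling \<open>b 0\<close> in extended
      reals.\<close>
    moreover have "b 0 \<noteq> \<top>"
      using N(1) by (simp add: b_def prob_space.finite_measure finite_measure.emeasure_finite)
    ultimately have b: "(\<Sum>j<n. b (Suc j)) = (\<Sum>j<n. b j)"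
      by (simp add: add.commute ennreal_add_left_cancel)
    have "emeasure (distr M M f) A = emeasure M (f -` A)"
      using emeasure_distr[OF fM, of A] A by (simp add: sM spM)
    also have "\<dots> = ennreal (1 / real n) * (\<Sum>j<n. b (Suc j))"
      by (simp add: eM[OF fA'] a_def b_def vimage_comp)
    also have "\<dots> = emeasure M A"
      unfolding b by (simp add: eM[OF A] a_def b_def)
    finally show "emeasure (distr M M f) A = emeasure M A" .
  qed simp
  ultimately have "M \<in> invariant_measures f"
    by (simp add: invariant_measures_def borel_probability_measures_def sM)
  then show ?thesis using eM that by (simp add: a_def)
qed

text \<open>The summand \<open>j = 0\<close> of the average is \<nu> divided by \<open>n\<close>. As
  the average is \<mu>, every \<mu>-null set is \<nu>-null, and ergodicity of \<mu> gives
  equality.\<close>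

lemma invariant_measures_funpow_of_ergodic:
  fixes f :: "'a::metric_space \<Rightarrow> 'a"
  assumes f: "f \<in> borel_measurable borel" and g: "g \<in> borel_measurable borel"
    and gf: "\<And>x. g (f x) = x"
    and unique: "invariant_measures f = {\<mu>}" and \<mu>: "\<mu> \<in> ergodic_measures (f ^^ n)" and n: "n > 0"
  shows "invariant_measures (f ^^ n) = {\<mu>}"
proof (intro equalityI subsetI)
  fix \<nu> assume \<nu>: "\<nu> \<in> invariant_measures (f ^^ n)"
  note N = invariant_measuresD[OF \<nu>]
  obtain M where "M \<in> invariant_measures f" and
    M: "\<And>A. A \<in> sets borel \<Longrightarrow>
       emeasure M A = ennreal (1 / real n) * (\<Sum>j<n. emeasure \<nu> ((f ^^ j) -` A))"
    using average_invariant_measure[OF f \<nu> n] by blast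
  with unique have "M = \<mu>" by auto
  have "absolutely_continuous \<mu> \<nu>"
    unfolding absolutely_continuous_def
  proof
    fix A assume "A \<in> null_sets \<mu>"
    then have A: "A \<in> sets borel" "emeasure \<mu> A = 0"
      using invariant_measuresD(2)[of \<mu> f] unique by auto
    with n have "\<forall>j<n. emeasure \<nu> ((f ^^ j) -` A) = 0"
      using M[of A] \<open>M = \<mu>\<close> by auto
    with n have "emeasure \<nu> A = 0" by (auto dest!: spec[of _ 0])
    with A show "A \<in> null_sets \<nu>" by (auto simp: N)
  qed
  moreover note borel_measurable_funpow[OF f] borel_measurable_funpow[OF g]
  moreover have "(g ^^ i) ((f ^^ i) x) = x" for i x
    by (induction i) (simp_all add: funpow_swap1[of g] gf)
  ultimately have "\<nu> = \<mu>"
    using ergodic_absolutely_continuous_unique[OF \<mu> \<nu>] by blast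
  then show "\<nu> \<in> {\<mu>}" by simp
qed (use invariant_measures_funpow[OF f] unique in auto)

section \<open>Continuous functions on compact metric spaces\<close>

lemma compact_Baire_nonempty:
  fixes \<G> :: "'a::metric_space set set"
  assumes "compact (UNIV :: 'a set)" "countable \<G>"
    and "\<And>G. G \<in> \<G> \<Longrightarrow> open G \<and> closure G = UNIV"
  shows "\<Inter>\<G> \<noteq> {}"
proof -
  have "compact_space (euclidean :: 'a topology)"
    using assms(1) by (simp add: compact_space_def)
  moreover have "Hausdorff_space (euclidean :: 'a topology)"
    by (simp add: Hausdorff_space_euclidean)
  ultimately have "locally_compact_space (euclidean :: 'a topology) \<and> regular_space (euclidean :: 'a topology)"
    by (simp add: compact_imp_locally_compact_space compact_Hausdorff_imp_regular_space)
  then have "euclidean closure_of \<Inter>\<G> = topspace (euclidean :: 'a topology)"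
    using assms by (intro Baire_category) auto
  then show ?thesis by auto
qed

lemma continuous_on_funpow:
  fixes T :: "'a::topological_space \<Rightarrow> 'a"
  assumes "continuous_on UNIV T"
  shows "continuous_on UNIV (T ^^ k)"
proof (induction k)
  case (Suc k)
  then show ?case using continuous_on_compose2[OF assms Suc] by (simp add: comp_def)
qed (simp add: id_def)

text \<open>Serves twice: as centres of the bump functions for separability, and as centres of
  countably many balls that a dense orbit has to visit.\<close>

lemma compact_finite_nets:
  assumes "compact (UNIV :: 'a::metric_space set)"
  obtains C :: "nat \<Rightarrow> 'a::metric_space set"
  where "\<And>n. finite (C n)" "\<And>n x. \<exists>c\<in>C n. dist x c < 1 / Suc n"
proof -
  have "\<exists>C. finite C \<and> (\<forall>x::'a. \<exists>c\<in>C. dist x c < 1 / Suc n)" for n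
  proof -
    obtain C where "finite C" "(UNIV :: 'a set) \<subseteq> (\<Union>c\<in>C. ball c (1 / Suc n))"
      using assms unfolding compact_eq_totally_bounded by (meson of_nat_0_less_iff zero_less_Suc zero_less_divide_1_iff)
    then show ?thesis
      by (intro exI[of _ C]) (auto simp: dist_commute subset_iff)
  qed
  then show ?thesis using that by metis
qed

text \<open>Partitions of unity on finer and finer finite nets, combined with rational coefficients,
  approximate uniformly because continuous functions are uniformly continuous here.\<close>

lemma separable_continuous_functions:
  assumes "compact (UNIV :: 'a::metric_space set)"
  obtains D :: "('a::metric_space \<Rightarrow> real) set" where "countable D" "\<And>\<psi>. \<psi> \<in> D \<Longrightarrow> continuous_on UNIV \<psi>"
    "\<And>\<phi> e. continuous_on UNIV \<phi> \<Longrightarrow> e > 0 \<Longrightarrow> \<exists>\<psi>\<in>D. \<forall>x. \<bar>\<phi> x - \<psi> x\<bar> \<le> e"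
proof -
  obtain C where C: "\<And>n. finite (C n)" "\<And>n x::'a. \<exists>c\<in>C n. dist x c < 1 / Suc n"
    using compact_finite_nets[OF assms] by blast
  \<comment> \<open>\<open>g n c\<close> is a bump vanishing at distance \<open>1 / Suc n\<close> or
    more from \<open>c\<close>, and \<open>G n\<close> is positive because \<open>C n\<close> is a
    net. Thus \<open>\<psi> n q\<close> is a weighted mean of the values \<open>q c\<close>.\<close>
  define g where "g n c x = max 0 (1 / Suc n - dist x c)" for n and c x :: 'a
  define G where "G n x = (\<Sum>c\<in>C n. g n c x)" for n x
  define \<psi> where "\<psi> n q x = (\<Sum>c\<in>C n. q c * g n c x) / G n x" for n q x
  have g_ge: "g n c x \<ge> 0" for n c x by (simp add: g_def)
  have G: "G n x > 0" for n x
  proof -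
    obtain c where "c \<in> C n" "dist x c < 1 / Suc n" using C(2) by blast
    then show ?thesis unfolding G_def
      by (intro sum_pos2[of _ c]) (use C(1) g_ge in \<open>auto simp: g_def\<close>)
  qed
  \<comment> \<open>Extensional coefficient functions on the finite set \<open>C n\<close> with
    rational values are countably many.\<close>
  define D where "D = (\<Union>n. \<psi> n ` (PiE (C n) (\<lambda>_. \<rat>)))"
  show ?thesis
  proof (rule that)
    have "countable (PiE (C n) (\<lambda>_. (\<rat> :: real set)))" for n
      by (rule countable_PiE) (use C(1) countable_rat in auto)
    then show "countable D" by (auto simp: D_def)
    show "continuous_on UNIV h" if "h \<in> D" for h
    proof -
      obtain n q where h: "h = \<psi> n q" using \<open>h \<in> D\<close> unfolding D_def by blast
      have 1: "continuous_on UNIV (g n c)" for c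
        unfolding g_def by (intro continuous_intros)
      have 2: "continuous_on UNIV (G n)"
        unfolding G_def by (intro continuous_on_sum 1)
      show ?thesis
        unfolding h \<psi>_def
        by (intro continuous_on_divide continuous_on_sum continuous_on_mult continuous_on_const 1 2)
           (use G in \<open>auto simp: less_imp_neq[symmetric]\<close>)
    qed
    show "\<exists>h\<in>D. \<forall>x. \<bar>\<phi> x - h x\<bar> \<le> e" if \<phi>: "continuous_on UNIV \<phi>" and e: "e > 0" for \<phi> :: "'a \<Rightarrow> real" and e
    proof -
      have "uniformly_continuous_on UNIV \<phi>"
        by (rule compact_uniformly_continuous[OF \<phi> assms])
      then obtain d where d: "d > 0" "\<And>x y. dist x y < d \<Longrightarrow> dist (\<phi> x) (\<phi> y) < e / 2"
        unfolding uniformly_continuous_on_def using e by (metis UNIV_I half_gt_zero)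
      obtain n where n: "1 / Suc n < d"
        using nat_approx_posE[OF d(1)] by auto
      have "\<exists>r\<in>\<rat>. \<bar>\<phi> c - r\<bar> < e / 2" for c
      proof -
        obtain r where "r \<in> \<rat>" "\<phi> c - e / 2 < r" "r < \<phi> c + e / 2"
          using Rats_dense_in_real[of "\<phi> c - e / 2" "\<phi> c + e / 2"] e by auto
        then show ?thesis by (intro bexI[of _ r] abs_diff_less_iff[THEN iffD2]) auto
      qed
      then obtain q where q: "\<And>c. q c \<in> \<rat>" "\<And>c. \<bar>\<phi> c - q c\<bar> < e / 2" by metis
      have "\<bar>\<phi> x - \<psi> n (restrict q (C n)) x\<bar> \<le> e" for x
      proof -
        \<comment> \<open>The error is a weighted mean of \<open>\<phi> x - q c\<close>. Only
          centres closer to \<open>x\<close> than \<open>1 / Suc n < d\<close> carry weight; for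
          these, uniform continuity and the choice of \<open>q\<close> contribute
          \<open>e / 2\<close> each.\<close>
        have "\<phi> x - \<psi> n (restrict q (C n)) x = (\<phi> x * G n x - (\<Sum>c\<in>C n. q c * g n c x)) / G n x"
          using G[of n x] by (simp add: \<psi>_def field_simps)
        also have "\<phi> x * G n x - (\<Sum>c\<in>C n. q c * g n c x) = (\<Sum>c\<in>C n. (\<phi> x - q c) * g n c x)"
          by (simp add: G_def sum_distrib_left sum_subtractf algebra_simps)
        finally have eq: "\<phi> x - \<psi> n (restrict q (C n)) x = (\<Sum>c\<in>C n. (\<phi> x - q c) * g n c x) / G n x" .
        have "\<bar>\<Sum>c\<in>C n. (\<phi> x - q c) * g n c x\<bar> \<le> (\<Sum>c\<in>C n. \<bar>(\<phi> x - q c) * g n c x\<bar>)"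
          by (rule sum_abs)
        also have "\<dots> \<le> (\<Sum>c\<in>C n. e * g n c x)"
        proof (rule sum_mono)
          fix c
          show "\<bar>(\<phi> x - q c) * g n c x\<bar> \<le> e * g n c x"
          proof (cases "dist x c < 1 / Suc n")
            case True
            then have "\<bar>\<phi> x - \<phi> c\<bar> < e / 2" using d(2)[of x c] n by (simp add: dist_real_def)
            with q(2)[of c] have "\<bar>\<phi> x - q c\<bar> \<le> e" by linarith
            then show ?thesis using g_ge[of n c x] by (simp add: abs_mult mult_right_mono)
          qed (simp add: g_def)
        qed
        also have "\<dots> = e * G n x" by (simp add: G_def sum_distrib_left)
        finally show ?thesis
          unfolding eq abs_divide abs_of_pos[OF G[of n x]] using G[of n x] by (simp add: divide_le_eq)
      qed
      moreover have "restrict q (C n) \<in> PiE (C n) (\<lambda>_. \<rat>)"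
        using q(1) by (simp add: PiE_iff)
      then have "\<psi> n (restrict q (C n)) \<in> D" unfolding D_def by blast
      ultimately show ?thesis by blast
    qed
  qed
qed

lemma integrable_continuous_borel_probability:
  assumes "compact (UNIV :: 'a::metric_space set)" "M \<in> borel_probability_measures"
    and "continuous_on UNIV (\<phi> :: 'a \<Rightarrow> real)"
  shows "integrable M \<phi>"
proof -
  have M: "prob_space M" "sets M = sets borel"
    using assms(2) by (auto simp: borel_probability_measures_def)
  interpret prob_space M by fact
  have "bounded (range \<phi>)"
    using compact_continuous_image[OF assms(3,1)] by (rule compact_imp_bounded)
  then obtain B where "\<And>x. norm (\<phi> x) \<le> B" by (auto simp: bounded_iff)
  moreover have "\<phi> \<in> borel_measurable M"
    using borel_measurable_continuous_onI[OF assms(3)] by (simp add: measurable_cong_sets[OF M(2) refl])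
  ultimately show ?thesis by (intro integrable_const_bound[of _ B]) auto
qed

section \<open>Accumulation points of empirical measures\<close>

text \<open>The finite sum makes continuity in \<open>x\<close> visible, which integrals against
  \<open>empirical_measure\<close> hide. At \<open>n = 0\<close> the value is 0.\<close>

definition time_average :: "('a \<Rightarrow> 'a) \<Rightarrow> ('a \<Rightarrow> real) \<Rightarrow> nat \<Rightarrow> 'a \<Rightarrow> real" where
  "time_average T \<phi> n x = (\<Sum>i<n. \<phi> ((T ^^ i) x)) / real n"

lemma integral_empirical_measure:
  assumes "n > 0" "continuous_on UNIV \<phi>"
  shows "(\<integral>y. \<phi> y \<partial>empirical_measure h x n) = time_average h \<phi> n x"
proof -
  let ?U = "uniform_count_measure {..<n}"
  \<comment> \<open>The empirical measure is the image of the uniform distribution on the times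
    below \<open>n\<close>, so its integrals become finite means.\<close>
  have eq: "empirical_measure h x n = distr ?U borel (\<lambda>i. (h ^^ i) x)"
  proof (rule measure_eqI)
    fix A assume "A \<in> sets (empirical_measure h x n)"
    then have A: "A \<in> sets borel" by simp
    have "emeasure (empirical_measure h x n) A
        = ennreal (1 / real n) * (\<Sum>i<n. indicator A ((h ^^ i) x))"
      using A by (simp add: emeasure_empirical_measure)
    also have "(\<Sum>i<n. indicator A ((h ^^ i) x)) = ennreal (real (card {i\<in>{..<n}. (h ^^ i) x \<in> A}))"
      by (simp add: indicator_def sum.If_cases ennreal_of_nat_eq_real_of_nat Int_def of_nat_sum)
    also have "ennreal (1 / real n) * \<dots> = emeasure ?U {i\<in>{..<n}. (h ^^ i) x \<in> A}"
      by (subst emeasure_uniform_count_measure) (auto simp: ennreal_mult[symmetric])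
    also have "\<dots> = emeasure (distr ?U borel (\<lambda>i. (h ^^ i) x)) A"
      using A by (subst emeasure_distr) (auto simp: space_uniform_count_measure vimage_def Int_def conj_commute)
    finally show "emeasure (empirical_measure h x n) A = emeasure (distr ?U borel (\<lambda>i. (h ^^ i) x)) A" .
  qed simp
  show ?thesis unfolding eq time_average_def
    by (subst integral_distr)
       (use borel_measurable_continuous_onI[OF assms(2)] in \<open>auto simp: integral_uniform_count_measure\<close>)
qed

text \<open>Induction over the generation of the topology from its subbasis. For an intersection,
  unite the sets of test functions and take the smaller tolerance.\<close>

lemma weak_star_neighbourhood:
  assumes "openin weak_star_topology U" "\<nu> \<in> U"
  shows "\<exists>\<Phi> e. finite \<Phi> \<and> (\<forall>\<phi>\<in>\<Phi>. continuous_on UNIV \<phi>) \<and> e > 0 \<and>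
      (\<forall>M\<in>borel_probability_measures.
         (\<forall>\<phi>\<in>\<Phi>. \<bar>(\<integral>x. \<phi> x \<partial>M) - (\<integral>x. \<phi> x \<partial>\<nu>)\<bar> < (e::real)) \<longrightarrow> M \<in> U)"
  using openin_topology_generated_by[OF assms(1)[unfolded weak_star_topology_def]] assms(2)
proof (induction rule: generate_topology_on.induct)
  case (Int a b)
  then have ab: "\<nu> \<in> a" "\<nu> \<in> b" by auto
  from Int.IH(1)[OF ab(1)] obtain \<Phi> :: "('a \<Rightarrow> real) set" and e :: real where
    1: "finite \<Phi>" "\<forall>\<phi>\<in>\<Phi>. continuous_on UNIV \<phi>" "e > 0"
      "\<forall>M\<in>borel_probability_measures.
       (\<forall>\<phi>\<in>\<Phi>. \<bar>(\<integral>x. \<phi> x \<partial>M) - (\<integral>x. \<phi> x \<partial>\<nu>)\<bar> < e) \<longrightarrow> M \<in> a"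
    by (elim exE conjE) (rule that)
  from Int.IH(2)[OF ab(2)] obtain \<Phi>' :: "('a \<Rightarrow> real) set" and e' :: real where
    2: "finite \<Phi>'" "\<forall>\<phi>\<in>\<Phi>'. continuous_on UNIV \<phi>" "e' > 0"
      "\<forall>M\<in>borel_probability_measures.
       (\<forall>\<phi>\<in>\<Phi>'. \<bar>(\<integral>x. \<phi> x \<partial>M) - (\<integral>x. \<phi> x \<partial>\<nu>)\<bar> < e') \<longrightarrow> M \<in> b"
    by (elim exE conjE) (rule that)
  show ?case
  proof (intro exI conjI ballI impI)
    show "finite (\<Phi> \<union> \<Phi>')" "min e e' > 0" using 1(1,3) 2(1,3) by auto
    show "continuous_on UNIV \<phi>" if "\<phi> \<in> \<Phi> \<union> \<Phi>'" for \<phi> using that 1(2) 2(2) by blast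
    fix M :: "'a measure"
    assume M: "M \<in> borel_probability_measures"
      "\<forall>\<phi>\<in>\<Phi> \<union> \<Phi>'. \<bar>(\<integral>x. \<phi> x \<partial>M) - (\<integral>x. \<phi> x \<partial>\<nu>)\<bar> < min e e'"
    then have "\<forall>\<phi>\<in>\<Phi>. \<bar>(\<integral>x. \<phi> x \<partial>M) - (\<integral>x. \<phi> x \<partial>\<nu>)\<bar> < e"
      "\<forall>\<phi>\<in>\<Phi>'. \<bar>(\<integral>x. \<phi> x \<partial>M) - (\<integral>x. \<phi> x \<partial>\<nu>)\<bar> < e'" by simp_all
    then show "M \<in> a \<inter> b" using bspec[OF 1(4) M(1)] bspec[OF 2(4) M(1)] by (simp only: Int_iff simp_thms)
  qed
next
  case (UN K)
  from UN.prems obtain k where "k \<in> K" "\<nu> \<in> k" by blast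
  from UN.IH[OF this] obtain \<Phi> :: "('a \<Rightarrow> real) set" and e :: real where
    \<Phi>: "finite \<Phi>" "\<forall>\<phi>\<in>\<Phi>. continuous_on UNIV \<phi>" "e > 0"
      "\<forall>M\<in>borel_probability_measures.
       (\<forall>\<phi>\<in>\<Phi>. \<bar>(\<integral>x. \<phi> x \<partial>M) - (\<integral>x. \<phi> x \<partial>\<nu>)\<bar> < e) \<longrightarrow> M \<in> k"
    by (elim exE conjE) (rule that)
  show ?case
    by (intro exI[of _ \<Phi>] exI[of _ e] conjI \<Phi>(1-3) ballI impI UnionI[OF \<open>k \<in> K\<close>])
       (rule \<Phi>(4)[rule_format], simp_all)
next
  case (Basis s)
  from Basis(1) obtain \<phi> and W :: "real set" where s: "s = {M \<in> borel_probability_measures. (\<integral>x. \<phi> x \<partial>M) \<in> W}"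
    and \<phi>: "continuous_on UNIV \<phi>" and W: "open W"
    by (elim CollectE exE conjE) (rule that)
  have "(\<integral>x. \<phi> x \<partial>\<nu>) \<in> W" using Basis.prems unfolding s by simp
  then obtain e where "e > 0" "ball (\<integral>x. \<phi> x \<partial>\<nu>) e \<subseteq> W"
    using W by (meson open_contains_ball)
  then show ?case
    by (intro exI[of _ "{\<phi>}"] exI[of _ e])
      (auto simp: \<phi> s subset_iff dist_real_def abs_minus_commute)
qed simp

text \<open>Trades weak-star neighbourhoods for time averages. Finite sets of test functions are
  tested together, since frequent closeness for each function alone would not provide common indices
  \<open>n\<close>.\<close>

lemma V_set_iff:
  "\<nu> \<in> V_set T x \<longleftrightarrow> \<nu> \<in> borel_probability_measures \<and>
    (\<forall>\<Phi> e. finite \<Phi> \<longrightarrow> (\<forall>\<phi>\<in>\<Phi>. continuous_on UNIV \<phi>) \<longrightarrow> (e::real) > 0 \<longrightarrow>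
      (\<exists>\<^sub>F n in sequentially. \<forall>\<phi>\<in>\<Phi>. \<bar>time_average T \<phi> n x - (\<integral>y. \<phi> y \<partial>\<nu>)\<bar> < e))"
  (is "?L \<longleftrightarrow> ?R")
proof
  assume ?L
  then have \<nu>: "\<nu> \<in> borel_probability_measures" and
    freq: "\<And>U. openin weak_star_topology U \<Longrightarrow> \<nu> \<in> U \<Longrightarrow>
      \<exists>\<^sub>F n in sequentially. empirical_measure T x n \<in> U"
    by (auto simp: V_set_def accumulation_points_def topspace_weak_star_topology)
  have "\<exists>\<^sub>F n in sequentially. \<forall>\<phi>\<in>\<Phi>. \<bar>time_average T \<phi> n x - (\<integral>y. \<phi> y \<partial>\<nu>)\<bar> < e"
    if \<Phi>: "finite \<Phi>" "\<forall>\<phi>\<in>\<Phi>. continuous_on UNIV \<phi>" "e > 0" for \<Phi> and e :: real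
  proof -
    define U where "U \<phi> = {M \<in> borel_probability_measures.
      (\<integral>y. \<phi> y \<partial>M) \<in> ball (\<integral>y. \<phi> y \<partial>\<nu>) e}" for \<phi> :: "'a \<Rightarrow> real"
    have U: "openin weak_star_topology (U \<phi>)" if "\<phi> \<in> \<Phi>" for \<phi>
      unfolding weak_star_topology_def U_def
      by (intro topology_generated_by_Basis CollectI exI[of _ \<phi>] exI[of _ "ball (\<integral>y. \<phi> y \<partial>\<nu>) e"] conjI refl) (use \<Phi> that in auto)
    \<comment> \<open>The factor \<open>borel_probability_measures\<close> keeps the set inside the
      space when \<open>\<Phi>\<close> is empty and the bare intersection is
      \<open>UNIV\<close>.\<close>
    have "openin weak_star_topology (borel_probability_measures \<inter> \<Inter>(U ` \<Phi>))"
      using \<Phi>(1) U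
    proof (induction \<Phi>)
      case empty
      show ?case
        using openin_topspace[of weak_star_topology] by (simp add: topspace_weak_star_topology)
    next
      case (insert \<phi> \<Phi>)
      then have "openin weak_star_topology (U \<phi> \<inter> (borel_probability_measures \<inter> \<Inter>(U ` \<Phi>)))"
        by (auto intro!: openin_Int[of _ "U \<phi>" "borel_probability_measures \<inter> \<Inter>(U ` \<Phi>)"])
      moreover have "U \<phi> \<inter> (borel_probability_measures \<inter> \<Inter>(U ` \<Phi>)) =
          borel_probability_measures \<inter> \<Inter>(U ` insert \<phi> \<Phi>)" by auto
      ultimately show ?case by (simp only:)
    qed
    then have "\<exists>\<^sub>F n in sequentially. empirical_measure T x n \<in> borel_probability_measures \<inter> \<Inter>(U ` \<Phi>)"
      by (rule freq) (use \<nu> \<Phi> in \<open>auto simp: U_def\<close>)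
    then show ?thesis
    proof (rule frequently_rev_mp)
      \<comment> \<open>Index 0 is discarded, because the formula for integrals against the
        empirical measure requires \<open>n > 0\<close>.\<close>
      show "\<forall>\<^sub>F n in sequentially. empirical_measure T x n \<in> borel_probability_measures \<inter> \<Inter>(U ` \<Phi>) \<longrightarrow>
          (\<forall>\<phi>\<in>\<Phi>. \<bar>time_average T \<phi> n x - (\<integral>y. \<phi> y \<partial>\<nu>)\<bar> < e)"
        using eventually_gt_at_top[of 0]
      proof eventually_elim
        case (elim n)
        then show ?case
        proof (intro impI ballI)
          fix \<phi> assume "empirical_measure T x n \<in> borel_probability_measures \<inter> \<Inter>(U ` \<Phi>)" "\<phi> \<in> \<Phi>"
          then have "(\<integral>y. \<phi> y \<partial>empirical_measure T x n) \<in> ball (\<integral>y. \<phi> y \<partial>\<nu>) e"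
            by (auto simp: U_def)
          then show "\<bar>time_average T \<phi> n x - (\<integral>y. \<phi> y \<partial>\<nu>)\<bar> < e"
            using \<Phi>(2) \<open>\<phi> \<in> \<Phi>\<close> integral_empirical_measure[OF elim, of \<phi> T x]
            by (simp add: dist_real_def abs_minus_commute)
        qed
      qed
    qed
  qed
  with \<nu> show ?R by (intro conjI allI impI)
next
  assume R: ?R
  have "\<exists>\<^sub>F n in sequentially. empirical_measure T x n \<in> U"
    if U: "openin weak_star_topology U" "\<nu> \<in> U" for U
  proof -
    obtain \<Phi> :: "('a \<Rightarrow> real) set" and e :: real
      where \<Phi>: "finite \<Phi>" "\<forall>\<phi>\<in>\<Phi>. continuous_on UNIV \<phi>" "e > 0"
      and U': "\<forall>M\<in>borel_probability_measures.
         (\<forall>\<phi>\<in>\<Phi>. \<bar>(\<integral>x. \<phi> x \<partial>M) - (\<integral>x. \<phi> x \<partial>\<nu>)\<bar> < e) \<longrightarrow> M \<in> U"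
      using weak_star_neighbourhood[OF U] by (elim exE conjE) (rule that)
    then have "\<exists>\<^sub>F n in sequentially. \<forall>\<phi>\<in>\<Phi>. \<bar>time_average T \<phi> n x - (\<integral>y. \<phi> y \<partial>\<nu>)\<bar> < e"
      by (intro conjunct2[OF R, rule_format] bspec[OF \<Phi>(2)] \<Phi>(1,3))
    then show ?thesis
    proof (rule frequently_rev_mp)
      show "\<forall>\<^sub>F n in sequentially. (\<forall>\<phi>\<in>\<Phi>. \<bar>time_average T \<phi> n x - (\<integral>y. \<phi> y \<partial>\<nu>)\<bar> < e) \<longrightarrow>
          empirical_measure T x n \<in> U"
        using eventually_gt_at_top[of 0]
      proof eventually_elim
        case (elim n)
        show ?case
        proof
          assume *: "\<forall>\<phi>\<in>\<Phi>. \<bar>time_average T \<phi> n x - (\<integral>y. \<phi> y \<partial>\<nu>)\<bar> < e"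
          show "empirical_measure T x n \<in> U"
          proof (rule U'[rule_format])
            show "empirical_measure T x n \<in> borel_probability_measures"
              by (rule empirical_measure_in_borel_probability_measures[OF elim])
            show "\<bar>(\<integral>y. \<phi> y \<partial>empirical_measure T x n) - (\<integral>y. \<phi> y \<partial>\<nu>)\<bar> < e" if "\<phi> \<in> \<Phi>" for \<phi>
              using * that \<Phi>(2) integral_empirical_measure[OF elim, of \<phi> T x] by simp
          qed
        qed
      qed
    qed
  qed
  then show ?L
    unfolding V_set_def accumulation_points_def topspace_weak_star_topology
    by (intro CollectI conjI conjunct1[OF R] allI impI) (elim conjE)
qed

section \<open>Accumulating measures along orbits and on residual sets\<close>

lemma V_setD:
  assumes "\<nu> \<in> V_set T x" "finite \<Phi>" "\<And>\<phi>. \<phi> \<in> \<Phi> \<Longrightarrow> continuous_on UNIV \<phi>" "(e::real) > 0"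
  shows "\<exists>\<^sub>F n in sequentially. \<forall>\<phi>\<in>\<Phi>. \<bar>time_average T \<phi> n x - (\<integral>y. \<phi> y \<partial>\<nu>)\<bar> < e"
  by (intro conjunct2[OF assms(1)[unfolded V_set_iff], rule_format] assms)

text \<open>The two sums telescope: the averages at \<open>x\<close> and \<open>T x\<close> differ
  by at most \<open>2 * B / n\<close>. Iterating carries an accumulating measure along the whole
  orbit.\<close>

lemma V_set_image:
  assumes T: "compact (UNIV :: 'a::metric_space set)" and \<nu>: "\<nu> \<in> V_set T (x :: 'a)"
  shows "\<nu> \<in> V_set T (T x)"
  unfolding V_set_iff
proof (intro conjI allI impI)
  show "\<nu> \<in> borel_probability_measures" using \<nu> by (simp add: V_set_iff)
  fix \<Phi> :: "('a \<Rightarrow> real) set" and e :: real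
  assume \<Phi>: "finite \<Phi>" "\<forall>\<phi>\<in>\<Phi>. continuous_on UNIV \<phi>" "e > 0"
  have "\<forall>\<^sub>F n in sequentially. \<bar>time_average T \<phi> n (T x) - time_average T \<phi> n x\<bar> < e / 2"
    if \<phi>: "\<phi> \<in> \<Phi>" for \<phi>
  proof -
    have "bounded (range \<phi>)"
      using compact_continuous_image[OF _ T, of \<phi>] \<Phi>(2) \<phi> by (auto intro: compact_imp_bounded)
    then obtain B where B: "\<And>x. \<bar>\<phi> x\<bar> \<le> B" by (auto simp: bounded_iff)
    have "(\<lambda>n. 2 * B / real n) \<longlonglongrightarrow> 0"
      by (rule lim_const_over_n)
    then have "\<forall>\<^sub>F n in sequentially. 2 * B / real n < e / 2"
      by (rule order_tendstoD) (use \<Phi> in simp)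
    then show ?thesis using eventually_gt_at_top[of 0]
    proof eventually_elim
      case (elim n)
      have "(\<Sum>i<n. \<phi> ((T ^^ i) (T x))) - (\<Sum>i<n. \<phi> ((T ^^ i) x)) = \<phi> ((T ^^ n) x) - \<phi> x"
        using sum_lessThan_telescope[of "\<lambda>i. \<phi> ((T ^^ i) x)" n]
        by (simp add: sum_subtractf funpow_swap1)
      then have "time_average T \<phi> n (T x) - time_average T \<phi> n x = (\<phi> ((T ^^ n) x) - \<phi> x) / real n"
        by (simp add: time_average_def flip: diff_divide_distrib)
      moreover have "\<bar>\<phi> ((T ^^ n) x) - \<phi> x\<bar> \<le> 2 * B"
        using B[of x] B[of "(T ^^ n) x"] by linarith
      ultimately have "\<bar>time_average T \<phi> n (T x) - time_average T \<phi> n x\<bar> \<le> 2 * B / real n"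
        using elim by (simp add: divide_right_mono)
      with elim show ?case by simp
    qed
  qed
  then have ev: "\<forall>\<^sub>F n in sequentially. \<forall>\<phi>\<in>\<Phi>. \<bar>time_average T \<phi> n (T x) - time_average T \<phi> n x\<bar> < e / 2"
    using \<Phi>(1) by (simp add: eventually_ball_finite_distrib)
  have fr: "\<exists>\<^sub>F n in sequentially. \<forall>\<phi>\<in>\<Phi>. \<bar>time_average T \<phi> n x - (\<integral>y. \<phi> y \<partial>\<nu>)\<bar> < e / 2"
    by (rule V_setD[OF \<nu> \<Phi>(1)]) (use \<Phi> in auto)
  show "\<exists>\<^sub>F n in sequentially. \<forall>\<phi>\<in>\<Phi>. \<bar>time_average T \<phi> n (T x) - (\<integral>y. \<phi> y \<partial>\<nu>)\<bar> < e"
  proof (rule frequently_rev_mp[OF fr eventually_mono[OF ev]])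
    fix n assume n: "\<forall>\<phi>\<in>\<Phi>. \<bar>time_average T \<phi> n (T x) - time_average T \<phi> n x\<bar> < e / 2"
    show "(\<forall>\<phi>\<in>\<Phi>. \<bar>time_average T \<phi> n x - (\<integral>y. \<phi> y \<partial>\<nu>)\<bar> < e / 2) \<longrightarrow>
        (\<forall>\<phi>\<in>\<Phi>. \<bar>time_average T \<phi> n (T x) - (\<integral>y. \<phi> y \<partial>\<nu>)\<bar> < e)"
    proof (intro impI ballI)
      fix \<phi> assume a: "\<forall>\<phi>\<in>\<Phi>. \<bar>time_average T \<phi> n x - (\<integral>y. \<phi> y \<partial>\<nu>)\<bar> < e / 2" and "\<phi> \<in> \<Phi>"
      then have "\<bar>time_average T \<phi> n x - (\<integral>y. \<phi> y \<partial>\<nu>)\<bar> < e / 2"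
        "\<bar>time_average T \<phi> n (T x) - time_average T \<phi> n x\<bar> < e / 2" using n by auto
      then show "\<bar>time_average T \<phi> n (T x) - (\<integral>y. \<phi> y \<partial>\<nu>)\<bar> < e" by linarith
    qed
  qed
qed

text \<open>As \<open>f\<close> commutes with \<open>T\<close>, averages of \<open>\<phi>\<close>
  along the orbit of \<open>f x\<close> are averages of \<open>\<phi> \<circ> f\<close> along that
  of \<open>x\<close>.\<close>

lemma V_set_distr:
  fixes f :: "'a::metric_space \<Rightarrow> 'a"
  assumes f: "continuous_on UNIV f" and comm: "\<And>x. T (f x) = f (T x)" and \<nu>: "\<nu> \<in> V_set T x"
  shows "distr \<nu> borel f \<in> V_set T (f x)"
  unfolding V_set_iff
proof (intro conjI allI impI)
  have \<nu>': "\<nu> \<in> borel_probability_measures" using \<nu> by (simp add: V_set_iff)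
  then have N: "prob_space \<nu>" "sets \<nu> = sets borel" by (auto simp: borel_probability_measures_def)
  have fm: "f \<in> measurable \<nu> borel"
    using borel_measurable_continuous_onI[OF f] by (simp add: measurable_cong_sets[OF N(2) refl])
  show "distr \<nu> borel f \<in> borel_probability_measures"
    using prob_space.prob_space_distr[OF N(1) fm] by (simp add: borel_probability_measures_def)
  fix \<Phi> :: "('a \<Rightarrow> real) set" and e :: real
  assume \<Phi>: "finite \<Phi>" "\<forall>\<phi>\<in>\<Phi>. continuous_on UNIV \<phi>" "e > 0"
  have "finite ((\<lambda>\<phi>. \<phi> \<circ> f) ` \<Phi>)" using \<Phi> by simp
  moreover have "\<forall>\<psi>\<in>(\<lambda>\<phi>. \<phi> \<circ> f) ` \<Phi>. continuous_on UNIV \<psi>"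
    using \<Phi>(2) by (auto simp: comp_def intro: continuous_on_compose2[OF _ f])
  ultimately have "\<exists>\<^sub>F n in sequentially. \<forall>\<psi>\<in>(\<lambda>\<phi>. \<phi> \<circ> f) ` \<Phi>. \<bar>time_average T \<psi> n x - (\<integral>y. \<psi> y \<partial>\<nu>)\<bar> < e"
    using \<Phi>(3) by (intro V_setD[OF \<nu>]) blast+
  moreover have "(T ^^ i) (f x) = f ((T ^^ i) x)" for i
    by (induction i) (simp_all add: comm)
  moreover have "(\<integral>y. \<phi> y \<partial>distr \<nu> borel f) = (\<integral>y. \<phi> (f y) \<partial>\<nu>)" if "\<phi> \<in> \<Phi>" for \<phi>
    using \<Phi>(2) that by (intro integral_distr fm borel_measurable_continuous_onI) auto
  ultimately show "\<exists>\<^sub>F n in sequentially. \<forall>\<phi>\<in>\<Phi>.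
      \<bar>time_average T \<phi> n (f x) - (\<integral>y. \<phi> y \<partial>distr \<nu> borel f)\<bar> < e"
    by (simp add: time_average_def comp_def)
qed

text \<open>With test functions taken from a countable uniformly dense set, accumulation at \<nu>
  follows from countably many open conditions. Each of them holds on the dense orbit. Returning the
  family of open sets lets two such families be united before applying Baire.\<close>

lemma V_set_residual:
  fixes T :: "'a::metric_space \<Rightarrow> 'a"
  assumes X: "compact (UNIV :: 'a set)" and T: "continuous_on UNIV T"
    and dense: "closure (range (\<lambda>k. (T ^^ k) x)) = UNIV" and \<nu>: "\<nu> \<in> V_set T x"
  obtains \<G> where "countable \<G>" "\<And>G. G \<in> \<G> \<Longrightarrow> open G \<and> closure G = UNIV"
    "\<And>y. y \<in> \<Inter>\<G> \<Longrightarrow> \<nu> \<in> V_set T y"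
proof -
  have \<nu>': "\<nu> \<in> borel_probability_measures" using \<nu> by (simp add: V_set_iff)
  interpret prob_space \<nu> using \<nu>' by (simp add: borel_probability_measures_def)
  obtain D :: "('a \<Rightarrow> real) set" where D: "countable D" "\<And>\<psi>. \<psi> \<in> D \<Longrightarrow> continuous_on UNIV \<psi>"
    "\<And>\<phi> e. continuous_on UNIV \<phi> \<Longrightarrow> e > 0 \<Longrightarrow> \<exists>\<psi>\<in>D. \<forall>x. \<bar>\<phi> x - \<psi> x\<bar> \<le> e"
    using separable_continuous_functions[OF X] by blast
  \<comment> \<open>\<open>m\<close> sets the tolerance; letting \<open>N\<close> range over all
    naturals encodes "for infinitely many \<open>n\<close>".\<close>
  define W where "W = (\<lambda>(F, m, N). {y. \<exists>n\<ge>N. \<forall>\<psi>\<in>F. \<bar>time_average T \<psi> n y - (\<integral>z. \<psi> z \<partial>\<nu>)\<bar> < 1 / Suc m})"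
  define \<G> where "\<G> = W ` ({F. finite F \<and> F \<subseteq> D} \<times> UNIV \<times> UNIV)"
  note Tk = continuous_on_funpow[OF T]
  have orbit: "\<nu> \<in> V_set T ((T ^^ k) x)" for k
    by (induction k) (simp_all add: \<nu> V_set_image[OF X])
  show ?thesis
  proof (rule that)
    show "countable \<G>"
      unfolding \<G>_def using countable_Collect_finite_subset[OF D(1)] by (intro countable_image countable_SIGMA) auto
  next
    fix G assume "G \<in> \<G>"
    then obtain F m N where F: "finite F" "F \<subseteq> D" and G: "G = W (F, m, N)"
      by (auto simp: \<G>_def)
    have cont: "continuous_on UNIV (time_average T \<psi> n)" if "\<psi> \<in> F" for \<psi> n
    proof -
      have "continuous_on UNIV (\<lambda>y. \<psi> ((T ^^ i) y))" for i
        by (rule continuous_on_compose2[OF _ Tk]) (use D(2) F that in auto)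
      then show ?thesis
        unfolding time_average_def divide_inverse by (intro continuous_on_mult continuous_on_sum continuous_on_const)
    qed
    have "G = (\<Union>n\<in>{N..}. \<Inter>\<psi>\<in>F. {y. \<bar>time_average T \<psi> n y - (\<integral>z. \<psi> z \<partial>\<nu>)\<bar> < 1 / Suc m})"
      by (auto simp: G W_def)
    also have "open \<dots>"
      by (intro open_UN ballI open_INT F open_Collect_less continuous_intros cont)
    finally have "open G" .
    moreover have "range (\<lambda>k. (T ^^ k) x) \<subseteq> G"
    proof (intro subsetI, elim rangeE)
      fix y k assume y: "y = (T ^^ k) x"
      have "\<exists>\<^sub>F n in sequentially. \<forall>\<psi>\<in>F. \<bar>time_average T \<psi> n y - (\<integral>z. \<psi> z \<partial>\<nu>)\<bar> < 1 / Suc m"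
      proof -
        show ?thesis
          unfolding y by (rule V_setD[OF orbit F(1)]) (use F(2) D(2) in auto)
      qed
      then show "y \<in> G" unfolding G W_def frequently_sequentially by simp
    qed
    then have "closure G = UNIV" using closure_mono dense by blast
    ultimately show "open G \<and> closure G = UNIV" by blast
  next
    fix y assume y: "y \<in> \<Inter>\<G>"
    show "\<nu> \<in> V_set T y"
      unfolding V_set_iff
    proof (intro conjI allI impI \<nu>')
      fix \<Phi> :: "('a \<Rightarrow> real) set" and e :: real
      assume \<Phi>: "finite \<Phi>" "\<forall>\<phi>\<in>\<Phi>. continuous_on UNIV \<phi>" "e > 0"
      \<comment> \<open>Three errors arise, from the average, the integral and membership in
        \<open>W\<close>. Each is at most \<open>e / 4\<close>, so their sum stays below
        \<open>e\<close>.\<close>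
      have "\<exists>\<psi>\<in>D. \<forall>x. \<bar>\<phi> x - \<psi> x\<bar> \<le> e / 4" if "\<phi> \<in> \<Phi>" for \<phi>
        using D(3)[of \<phi> "e / 4"] that \<Phi> by simp
      then obtain a where a: "\<And>\<phi>. \<phi> \<in> \<Phi> \<Longrightarrow> a \<phi> \<in> D" "\<And>\<phi> x. \<phi> \<in> \<Phi> \<Longrightarrow> \<bar>\<phi> x - a \<phi> x\<bar> \<le> e / 4"
        by metis
      obtain m where m: "1 / Suc m < e / 4"
        using nat_approx_posE[of "e / 4"] \<Phi>(3) by auto
      show "\<exists>\<^sub>F n in sequentially. \<forall>\<phi>\<in>\<Phi>. \<bar>time_average T \<phi> n y - (\<integral>y. \<phi> y \<partial>\<nu>)\<bar> < e"
        unfolding frequently_sequentially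
      proof
        fix N
        have "W (a ` \<Phi>, m, N) \<in> \<G>"
          unfolding \<G>_def by (rule imageI) (use \<Phi> a in auto)
        with y have "y \<in> W (a ` \<Phi>, m, N)" by blast
        then obtain n where n: "n \<ge> N"
          "\<And>\<phi>. \<phi> \<in> \<Phi> \<Longrightarrow> \<bar>time_average T (a \<phi>) n y - (\<integral>z. a \<phi> z \<partial>\<nu>)\<bar> < 1 / Suc m"
          by (auto simp: W_def)
        have "\<bar>time_average T \<phi> n y - (\<integral>y. \<phi> y \<partial>\<nu>)\<bar> < e" if \<phi>: "\<phi> \<in> \<Phi>" for \<phi>
        proof -
          have "\<bar>(\<Sum>i<n. \<phi> ((T ^^ i) y) - a \<phi> ((T ^^ i) y))\<bar> \<le> (\<Sum>i<n. e / 4)"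
            by (rule order_trans[OF sum_abs sum_mono]) (use a(2)[OF \<phi>] in auto)
          then have "\<bar>(\<Sum>i<n. \<phi> ((T ^^ i) y)) - (\<Sum>i<n. a \<phi> ((T ^^ i) y))\<bar> / real n \<le> (real n * (e / 4)) / real n"
            by (intro divide_right_mono) (simp_all add: sum_subtractf)
          then have "\<bar>time_average T \<phi> n y - time_average T (a \<phi>) n y\<bar> \<le> (real n * (e / 4)) / real n"
            by (simp only: time_average_def diff_divide_distrib[symmetric] abs_divide abs_of_nat)
          \<comment> \<open>An inequality only, since the quotient is 0 for
            \<open>n = 0\<close>.\<close>
          also have "\<dots> \<le> e / 4" using \<Phi>(3) by simp
          finally have 1: "\<bar>time_average T \<phi> n y - time_average T (a \<phi>) n y\<bar> \<le> e / 4" .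
          have int: "integrable \<nu> \<phi>" "integrable \<nu> (a \<phi>)"
            by (rule integrable_continuous_borel_probability[OF X \<nu>']; use \<Phi> \<phi> a(1) D(2) in blast)+
          have "\<bar>(\<integral>z. \<phi> z - a \<phi> z \<partial>\<nu>)\<bar> \<le> (\<integral>z. \<bar>\<phi> z - a \<phi> z\<bar> \<partial>\<nu>)"
            by (rule integral_abs_bound)
          also have "\<dots> \<le> (\<integral>z. e / 4 \<partial>\<nu>)"
            by (rule integral_mono) (use int a(2)[OF \<phi>] in auto)
          also have "\<dots> = e / 4" using prob_space by simp
          finally have "\<bar>(\<integral>z. \<phi> z \<partial>\<nu>) - (\<integral>z. a \<phi> z \<partial>\<nu>)\<bar> \<le> e / 4"
            using int by simp
          with 1 n(2)[OF \<phi>] m show ?thesis by linarith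
        qed
        with n(1) show "\<exists>n\<ge>N. \<forall>\<phi>\<in>\<Phi>. \<bar>time_average T \<phi> n y - (\<integral>y. \<phi> y \<partial>\<nu>)\<bar> < e"
          by blast
      qed
    qed
  qed
qed

section \<open>Dense orbits and the final argument\<close>

lemma transitive_dense_orbit:
  fixes T :: "'a::metric_space \<Rightarrow> 'a"
  assumes X: "compact (UNIV :: 'a set)" and T: "continuous_on UNIV T" and tr: "topologically_transitive T"
  obtains x where "closure (range (\<lambda>k. (T ^^ k) x)) = UNIV"
proof -
  obtain C where C: "\<And>n. finite (C n)" "\<And>n x::'a. \<exists>c\<in>C n. dist x c < 1 / Suc n"
    using compact_finite_nets[OF X] by blast
  \<comment> \<open>\<open>G (m, c)\<close> consists of the points whose orbit meets the ball around
    \<open>c\<close>. A point in all of these sets has a dense orbit, because the radii shrink and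
    the centres form nets.\<close>
  define G where "G = (\<lambda>(m, c). \<Union>k. (T ^^ k) -` ball c (1 / Suc m))"
  define \<G> where "\<G> = G ` (SIGMA m:UNIV. C m)"
  note Tk = continuous_on_funpow[OF T]
  have "\<Inter>\<G> \<noteq> {}"
  proof (rule compact_Baire_nonempty[OF X])
    show "countable \<G>"
      unfolding \<G>_def using countable_finite[OF C(1)] by (intro countable_image countable_SIGMA) auto
    fix U assume "U \<in> \<G>"
    then obtain m c where U: "U = (\<Union>k. (T ^^ k) -` ball c (1 / Suc m))"
      by (auto simp: \<G>_def G_def)
    have "open U" unfolding U by (intro open_UN ballI open_vimage Tk) simp
    moreover have "closure U = UNIV"
    proof (rule ccontr)
      assume "closure U \<noteq> UNIV"
      \<comment> \<open>Transitivity sends a point outside the closure of \<open>U\<close> into the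
        ball; but then that point belongs to \<open>U\<close>.\<close>
      then have "open (- closure U)" "- closure U \<noteq> {}" "ball c (1 / Suc m) \<noteq> {}" by auto
      then obtain k where "(T ^^ k) ` (- closure U) \<inter> ball c (1 / Suc m) \<noteq> {}"
        using tr unfolding topologically_transitive_def by (metis open_ball)
      then have "(- closure U) \<inter> U \<noteq> {}" unfolding U by blast
      then show False using closure_subset by blast
    qed
    ultimately show "open U \<and> closure U = UNIV" by blast
  qed
  then obtain x where x: "x \<in> \<Inter>\<G>" by blast
  have "y \<in> closure (range (\<lambda>k. (T ^^ k) x))" for y
    unfolding closure_approachable
  proof (intro allI impI)
    fix e :: real assume "e > 0"
    then obtain m where m: "1 / Suc m < e / 2" using nat_approx_posE[of "e / 2"] by auto
    obtain c where c: "c \<in> C m" "dist y c < 1 / Suc m" using C(2) by blast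
    then have "G (m, c) \<in> \<G>" unfolding \<G>_def by blast
    with x obtain k where "dist c ((T ^^ k) x) < 1 / Suc m" by (auto simp: G_def)
    with c m have "dist ((T ^^ k) x) y < e"
      using dist_triangle[of "(T ^^ k) x" y c] by (simp add: dist_commute)
    then show "\<exists>z\<in>range (\<lambda>k. (T ^^ k) x). dist z y < e" by blast
  qed
  then have "closure (range (\<lambda>k. (T ^^ k) x)) = UNIV" by blast
  then show ?thesis by (rule that)
qed

lemma ergodic_of_Q_e_UNIV:
  fixes f :: "'a::metric_space \<Rightarrow> 'a"
  assumes X: "compact (UNIV :: 'a set)" and f: "continuous_on UNIV f" "surj f"
    and unique: "invariant_measures f = {\<mu>}"
    and tr: "topologically_transitive (f ^^ p)" and Q: "Q_e (f ^^ p) = UNIV"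
  shows "\<mu> \<in> ergodic_measures (f ^^ p)"
proof -
  define T where "T = f ^^ p"
  have T: "continuous_on UNIV T"
    unfolding T_def by (rule continuous_on_funpow[OF f(1)])
  have comm: "T (f x) = f (T x)" for x by (simp add: T_def funpow_swap1)
  have commk: "(T ^^ k) (f x) = f ((T ^^ k) x)" for k x
    by (induction k) (simp_all add: comm)
  obtain x where x: "closure (range (\<lambda>k. (T ^^ k) x)) = UNIV"
    using transitive_dense_orbit[OF X T] tr by (auto simp: T_def)
  \<comment> \<open>The accumulation set at every point is a singleton, which is what later forces
    two measures accumulating at a common point to agree.\<close>
  have V: "\<exists>\<nu>\<in>ergodic_measures T. V_set T y = {\<nu>}" for y
  proof -
    have "y \<in> Q_e T" using Q by (simp add: T_def)
    then show ?thesis unfolding Q_e_def G_set_def by blast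
  qed
  then obtain \<nu> where \<nu>: "\<nu> \<in> ergodic_measures T" "V_set T x = {\<nu>}" by blast
  then have \<nu>x: "\<nu> \<in> V_set T x" by simp
  define \<nu>' where "\<nu>' = distr \<nu> borel f"
  have \<nu>': "\<nu>' \<in> V_set T (f x)"
    unfolding \<nu>'_def by (rule V_set_distr[of f T, OF f(1) comm]) (simp add: \<nu>)
  \<comment> \<open>A continuous surjection maps dense sets to dense sets, and \<open>f\<close> maps
    the \<open>T\<close>-orbit of \<open>x\<close> onto that of \<open>f x\<close>.\<close>
  have "f ` closure (range (\<lambda>k. (T ^^ k) x)) \<subseteq> closure (f ` range (\<lambda>k. (T ^^ k) x))"
    by (rule image_closure_subset) (simp_all add: f(1) x closure_subset)
  then have fx: "closure (range (\<lambda>k. (T ^^ k) (f x))) = UNIV"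
    using f(2) by (auto simp: x image_image commk)
  obtain \<G> where 1: "countable \<G>" "\<And>G. G \<in> \<G> \<Longrightarrow> open G \<and> closure G = UNIV"
    "\<And>y. y \<in> \<Inter>\<G> \<Longrightarrow> \<nu> \<in> V_set T y"
    using V_set_residual[OF X T x \<nu>x] by blast
  obtain \<G>' where 2: "countable \<G>'" "\<And>G. G \<in> \<G>' \<Longrightarrow> open G \<and> closure G = UNIV"
    "\<And>y. y \<in> \<Inter>\<G>' \<Longrightarrow> \<nu>' \<in> V_set T y"
    using V_set_residual[OF X T fx \<nu>'] by blast
  have "\<Inter>(\<G> \<union> \<G>') \<noteq> {}"
    by (rule compact_Baire_nonempty[OF X]) (use 1 2 in auto)
  then obtain y where "\<nu> \<in> V_set T y" "\<nu>' \<in> V_set T y" using 1(3) 2(3) by blast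
  with V[of y] have "\<nu>' = \<nu>" by auto
  have "\<nu> \<in> invariant_measures T" using \<nu> by (simp add: ergodic_measures_def)
  note N = invariant_measuresD[OF this]
  have "distr \<nu> \<nu> f = distr \<nu> borel f"
    by (rule distr_cong) (simp_all add: N)
  then have "\<nu> \<in> invariant_measures f"
    using N \<open>\<nu>' = \<nu>\<close> by (simp add: invariant_measures_def borel_probability_measures_def \<nu>'_def)
  then show ?thesis using unique \<nu> by (simp add: T_def)
qed

theorem theorem4:
  fixes f :: "'a::metric_space \<Rightarrow> 'a"
  assumes "dynamical_system f"
    and "totally_transitive f"
    and "uniquely_ergodic f"
    and "\<not> totally_uniquely_ergodic f"
  shows "\<exists>p::nat. prime p \<and> Q_e (f ^^ p) \<noteq> UNIV"
proof (rule ccontr)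
  assume "\<not> ?thesis"
  then have Q: "Q_e (f ^^ p) = UNIV" if "prime p" for p :: nat using that by blast
  obtain g where X: "compact (UNIV :: 'a set)" and g: "homeomorphism UNIV UNIV f g"
    using assms(1) by (auto simp: dynamical_system_def)
  have f: "continuous_on UNIV f" "surj f" "continuous_on UNIV g" "\<And>x. g (f x) = x"
    using g by (auto simp: homeomorphism_def)
  have fm: "f \<in> borel_measurable borel" "g \<in> borel_measurable borel"
    using f by (auto intro: borel_measurable_continuous_onI)
  obtain \<mu> where \<mu>: "invariant_measures f = {\<mu>}"
    using assms(3) by (auto simp: uniquely_ergodic_def)
  have primes: "\<mu> \<in> ergodic_measures (f ^^ p)" if "prime p" for p
    using ergodic_of_Q_e_UNIV[OF X f(1,2) \<mu> _ Q[OF that]] assms(2) prime_gt_0_nat[OF that]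
    by (auto simp: totally_transitive_def)
  \<comment> \<open>The coding argument also needs ergodicity for \<open>f\<close> itself, which the
    prime 2 supplies.\<close>
  have "\<mu> \<in> ergodic_measures f"
    using ergodic_measures_of_funpow[OF _ primes[OF two_is_prime_nat]] \<mu> by auto
  then have "\<mu> \<in> ergodic_measures (f ^^ n)" if "n > 0" for n
    using ergodic_funpow_of_primes[OF fm(1)] primes that by blast
  then have "invariant_measures (f ^^ n) = {\<mu>}" if "n > 0" for n
    using invariant_measures_funpow_of_ergodic[OF fm f(4) \<mu>] that by blast
  with \<mu> assms(4) show False by (auto simp: totally_uniquely_ergodic_def)
qed

end
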